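(* For all modal trees $\mathtt{T},\mathtt{S}$: if $\mathtt{T}\hookrightarrow^{*}\mathtt{S}$, then $\mathtt{T}\hookrightarrow^{\Omega}\mathtt{S}$ for some normal rewriting sequence $\Omega$.
   Context: Modal trees: recursively, pairs $\langle\Delta;\Gamma\rangle$ with $\Delta$ a finite list of propositional variables and $\Gamma$ a finite list of pairs $(\alpha,\mathtt{S})$, $\alpha<\omega$, $\mathtt{S}$ a modal tree. Positions: $\mathrm{Pos}(\langle\Delta;\varnothing\rangle)=\{\epsilon\}$; $\mathrm{Pos}(\langle\Delta;[(\alpha_1,\mathtt{S}_1),\dots,(\alpha_n,\mathtt{S}_n)]\rangle)=\{\epsilon\}\cup\bigcup_{i=1}^n\{i\mathbf{k}\mid\mathbf{k}\in\mathrm{Pos}(\mathtt{S}_i)\}$. Subtree: $\mathtt{T}|_\epsilon=\mathtt{T}$, $\mathtt{T}|_{i\mathbf{r}}=\mathtt{S}_i|_{\mathbf{r}}$. Replacement: $\mathtt{T}[\mathtt{S}]_\epsilon=\mathtt{S}$, $\mathtt{T}[\mathtt{S}]_{i\mathbf{r}}$ is $\mathtt{T}$ with its $i$-th child $\mathtt{S}_i$ replaced by $\mathtt{S}_i[\mathtt{S}]_{\mathbf{r}}$ (same edge label). List operations, for $0<i,j\le|\Gamma|$: $\#_i\Gamma$ is the $i$-th element; $\Gamma^{-i}$ deletes it; $\Gamma^{+i}=(\#_i\Gamma)\frown\Gamma$; $\Gamma[x]_i$ replaces the $i$-th element by $x$; $\Gamma^{i\leftrightarrow j}$ swaps the $i$-th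 and $j$-th elements; similarly $\Delta^{-n},\Delta^{+n}$. Rewriting rules of $\mathsf{TRC}$: for a modal tree $\mathtt{T}$, $\mathbf{k}\in\mathrm{Pos}(\mathtt{T})$ with $\mathtt{T}|_\mathbf{k}=\langle\Delta;\Gamma\rangle$: ($\rho^+$) $\mathtt{T}\hookrightarrow\mathtt{T}[\langle\Delta^{+i};\Gamma\rangle]_\mathbf{k}$, $0<i\le|\Delta|$; ($\rho^-$) $\mathtt{T}\hookrightarrow\mathtt{T}[\langle\Delta^{-i};\Gamma\rangle]_\mathbf{k}$; ($\sigma$) $\mathtt{T}\hookrightarrow\mathtt{T}[\langle\Delta;\Gamma^{i\leftrightarrow j}\rangle]_\mathbf{k}$, $i\neq j$; ($\pi^+$) $\mathtt{T}\hookrightarrow\mathtt{T}[\langle\Delta;\Gamma^{+i}\rangle]_\mathbf{k}$; ($\pi^-$) $\mathtt{T}\hookrightarrow\mathtt{T}[\langle\Delta;\Gamma^{-i}\rangle]_\mathbf{k}$; ($\mathfrak{4}$) if $\#_i\Gamma=(\beta,\langle\tilde\Delta;\tilde\Gamma\rangle)$ and $\#_j\tilde\Gamma=(\beta,\mathtt{S})$, then $\mathtt{T}\hookrightarrow\mathtt{T}[\langle\Delta;\Gamma[(\beta,\mathtt{S})]_i\rangle]_\mathbf{k}$; ($\lambda$) if $\#_i\Gamma=(\alpha,\mathtt{S})$ and $\alpha>\beta$, then $\mathtt{T}\hookrightarrow\mathtt{T}[\langle\Delta;\Gamma[(\beta,\mathtt{S})]_i\rangle]_\mathbf{k}$; ($\mathsf{J}$)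 if $i\ne j$, $\#_i\Gamma=(\alpha,\langle\tilde\Delta;\tilde\Gamma\rangle)$, $\#_j\Gamma=(\beta,\mathtt{S})$, $\alpha>\beta$, then $\mathtt{T}\hookrightarrow\mathtt{T}[\langle\Delta;(\Gamma[(\alpha,\langle\tilde\Delta;\tilde\Gamma\frown(\beta,\mathtt{S})\rangle)]_i)^{-j}\rangle]_\mathbf{k}$. $\hookrightarrow$ is the union of these relations, $\hookrightarrow^*$ its reflexive-transitive closure. Kinds: atomic $=\{\rho^+,\rho^-\}$, structural $=\{\sigma\}$, replicative $=\{\pi^+\}$, decreasing $=\{\pi^-,\mathfrak{4}\}$, modal $=\{\lambda,\mathsf{J}\}$. For a list $\Omega$ of rules, $\mathtt{T}\hookrightarrow^{\Omega}\mathtt{S}$ means: $\mathtt{S}=\mathtt{T}$ if $\Omega=\varnothing$, and $\mathtt{T}\hookrightarrow^{\mu}\mathtt{U}\hookrightarrow^{\hat\Omega}\mathtt{S}$ for some $\mathtt{U}$ if $\Omega=\mu\frown\hat\Omega$. A normal rewriting sequence is a list $\Omega_{\pi^+}\frown\Omega_\diamond\frown\Omega_\delta\frown\Omega_\rho\frown\Omega_\sigma$ where these are lists of replicative, modal, decreasing, atomic and structural rules respectively. *)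

theory Defs
  imports Main
begin

(* 'v is the type of propositional variables; edge labels alpha < omega are natural numbers. *)
datatype 'v mtree = MTree "'v list" "(nat \<times> 'v mtree) list"

(* List indices start at 1. All the following list operations are only meaningful
   for indices i, j with 0 < i, j \<le> length xs, which every use below requires. *)
definition valid_index :: "nat \<Rightarrow> 'a list \<Rightarrow> bool" where
  "valid_index i xs \<longleftrightarrow> 0 < i \<and> i \<le> length xs"

definition elem_at :: "'a list \<Rightarrow> nat \<Rightarrow> 'a" where
  "elem_at xs i = xs ! (i - 1)"

definition delete_at :: "'a list \<Rightarrow> nat \<Rightarrow> 'a list" where
  "delete_at xs i = take (i - 1) xs @ drop i xs"

definition duplicate_at :: "'a list \<Rightarrow> nat \<Rightarrow> 'a list" where
  "duplicate_at xs i = elem_at xs i # xs"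

definition replace_at :: "'a list \<Rightarrow> nat \<Rightarrow> 'a \<Rightarrow> 'a list" where
  "replace_at xs i x = xs[i - 1 := x]"

definition swap_at :: "'a list \<Rightarrow> nat \<Rightarrow> nat \<Rightarrow> 'a list" where
  "swap_at xs i j = xs[i - 1 := elem_at xs j, j - 1 := elem_at xs i]"

function Pos :: "'v mtree \<Rightarrow> nat list set" where
  "Pos (MTree \<Delta> \<Gamma>) =
     {[]} \<union> (\<Union>i\<in>{1..length \<Gamma>}. {i # k | k. k \<in> Pos (snd (elem_at \<Gamma> i))})"
  by pat_completeness auto
termination
proof (relation "measure size", goal_cases)
  case 1
  show ?case by simp
next
  case (2 \<Delta> \<Gamma> i)
  then have "elem_at \<Gamma> i \<in> set \<Gamma>"
    by (auto simp: elem_at_def)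
  moreover obtain a S where "elem_at \<Gamma> i = (a, S)"
    by fastforce
  ultimately show ?case
    using size_list_estimation'[of "(a, S)" \<Gamma> "size S" "size_prod (\<lambda>_. 0) size"] by simp
qed

(* subtree T k and graft T S k, i.e. T|_k and T[S]_k, are only meaningful for k in Pos T. *)
primrec subtree :: "'v mtree \<Rightarrow> nat list \<Rightarrow> 'v mtree" where
  "subtree T [] = T"
| "subtree T (i # r) = (case T of MTree \<Delta> \<Gamma> \<Rightarrow> subtree (snd (elem_at \<Gamma> i)) r)"

primrec graft :: "'v mtree \<Rightarrow> 'v mtree \<Rightarrow> nat list \<Rightarrow> 'v mtree" where
  "graft T S [] = S"
| "graft T S (i # r) =
     (case T of MTree \<Delta> \<Gamma> \<Rightarrow>
        (case elem_at \<Gamma> i of (\<alpha>, S') \<Rightarrow> MTree \<Delta> (replace_at \<Gamma> i (\<alpha>, graft S' S r))))"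

datatype trc_rule = Rho_plus | Rho_minus | Sigma | Pi_plus | Pi_minus | Four | Lambda | J

(* root_step \<mu> N N': the rule \<mu> replaces the subtree N at the chosen position by N'. *)
inductive root_step :: "trc_rule \<Rightarrow> 'v mtree \<Rightarrow> 'v mtree \<Rightarrow> bool" where
  rho_plus:
    "valid_index i \<Delta> \<Longrightarrow> root_step Rho_plus (MTree \<Delta> \<Gamma>) (MTree (duplicate_at \<Delta> i) \<Gamma>)"
| rho_minus:
    "valid_index i \<Delta> \<Longrightarrow> root_step Rho_minus (MTree \<Delta> \<Gamma>) (MTree (delete_at \<Delta> i) \<Gamma>)"
| sigma:
    "valid_index i \<Gamma> \<Longrightarrow> valid_index j \<Gamma> \<Longrightarrow> i \<noteq> j \<Longrightarrow>
     root_step Sigma (MTree \<Delta> \<Gamma>) (MTree \<Delta> (swap_at \<Gamma> i j))"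
| pi_plus:
    "valid_index i \<Gamma> \<Longrightarrow> root_step Pi_plus (MTree \<Delta> \<Gamma>) (MTree \<Delta> (duplicate_at \<Gamma> i))"
| pi_minus:
    "valid_index i \<Gamma> \<Longrightarrow> root_step Pi_minus (MTree \<Delta> \<Gamma>) (MTree \<Delta> (delete_at \<Gamma> i))"
| four:
    "valid_index i \<Gamma> \<Longrightarrow> elem_at \<Gamma> i = (\<beta>, MTree \<Delta>' \<Gamma>') \<Longrightarrow>
     valid_index j \<Gamma>' \<Longrightarrow> elem_at \<Gamma>' j = (\<beta>, S) \<Longrightarrow>
     root_step Four (MTree \<Delta> \<Gamma>) (MTree \<Delta> (replace_at \<Gamma> i (\<beta>, S)))"
| lambda:
    "valid_index i \<Gamma> \<Longrightarrow> elem_at \<Gamma> i = (\<alpha>, S) \<Longrightarrow> \<alpha> > \<beta> \<Longrightarrow>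
     root_step Lambda (MTree \<Delta> \<Gamma>) (MTree \<Delta> (replace_at \<Gamma> i (\<beta>, S)))"
| j:
    "valid_index i \<Gamma> \<Longrightarrow> valid_index j \<Gamma> \<Longrightarrow> i \<noteq> j \<Longrightarrow>
     elem_at \<Gamma> i = (\<alpha>, MTree \<Delta>' \<Gamma>') \<Longrightarrow> elem_at \<Gamma> j = (\<beta>, S) \<Longrightarrow> \<alpha> > \<beta> \<Longrightarrow>
     root_step J (MTree \<Delta> \<Gamma>)
       (MTree \<Delta> (delete_at (replace_at \<Gamma> i (\<alpha>, MTree \<Delta>' (\<Gamma>' @ [(\<beta>, S)]))) j))"

inductive rule_step :: "trc_rule \<Rightarrow> 'v mtree \<Rightarrow> 'v mtree \<Rightarrow> bool" where
  "k \<in> Pos T \<Longrightarrow> root_step \<mu> (subtree T k) N \<Longrightarrow> rule_step \<mu> T (graft T N k)"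

definition trc_step :: "'v mtree \<Rightarrow> 'v mtree \<Rightarrow> bool" (infix \<open>\<hookrightarrow>\<close> 50) where
  "T \<hookrightarrow> S \<longleftrightarrow> (\<exists>\<mu>. rule_step \<mu> T S)"

abbreviation trc_steps :: "'v mtree \<Rightarrow> 'v mtree \<Rightarrow> bool" (infix \<open>\<hookrightarrow>\<^sup>*\<close> 50) where
  "T \<hookrightarrow>\<^sup>* S \<equiv> trc_step\<^sup>*\<^sup>* T S"

primrec rule_seq :: "trc_rule list \<Rightarrow> 'v mtree \<Rightarrow> 'v mtree \<Rightarrow> bool" where
  "rule_seq [] T S \<longleftrightarrow> S = T"
| "rule_seq (\<mu> # \<Omega>) T S \<longleftrightarrow> (\<exists>U. rule_step \<mu> T U \<and> rule_seq \<Omega> U S)"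

definition atomic_rules :: "trc_rule set" where
  "atomic_rules = {Rho_plus, Rho_minus}"

definition structural_rules :: "trc_rule set" where
  "structural_rules = {Sigma}"

definition replicative_rules :: "trc_rule set" where
  "replicative_rules = {Pi_plus}"

definition decreasing_rules :: "trc_rule set" where
  "decreasing_rules = {Pi_minus, Four}"

definition modal_rules :: "trc_rule set" where
  "modal_rules = {Lambda, J}"

definition normal_seq :: "trc_rule list \<Rightarrow> bool" where
  "normal_seq \<Omega> \<longleftrightarrow>
     (\<exists>\<Omega>\<^sub>\<pi>\<in>lists replicative_rules. \<exists>\<Omega>\<^sub>m\<in>lists modal_rules. \<exists>\<Omega>\<^sub>\<delta>\<in>lists decreasing_rules.
      \<exists>\<Omega>\<^sub>\<rho>\<in>lists atomic_rules. \<exists>\<Omega>\<^sub>\<sigma>\<in>lists structural_rules.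
        \<Omega> = \<Omega>\<^sub>\<pi> @ \<Omega>\<^sub>m @ \<Omega>\<^sub>\<delta> @ \<Omega>\<^sub>\<rho> @ \<Omega>\<^sub>\<sigma>)"

end

(* Up to the order of children, modal trees are trees whose children form a multiset, and there
   sigma is the identity. On such trees the remaining rules are commuted past each other: a rule of
   a later phase followed by one of an earlier phase can be exchanged, possibly repeating steps.
   The delicate pair is J followed by pi+: duplicating a node that has absorbed a sibling forces two
   duplications before and two J steps after, so no exchange with a single step on one side exists.
   Replacing pi+ by a parallel duplication, which duplicates at all positions at once, restores
   such an exchange. Finally the sequence is lifted back to lists; both ends then agree as
   multisets of children, and sigma steps sort the lists. *)
theory Submission
  imports Defs "HOL-Library.Multiset"
begin

section \<open>Trees up to the order of children\<close>

text \<open>An exchange of single steps that allows repetitions on both sides does not in general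
  extend to whole runs, since every repetition opens further exchanges. So each pair of phases needs
  an exchange in which one side keeps at most one step. Pushing \<open>Four\<close> behind a modal
  rule may double the modal step but leaves a single \<open>Four\<close>; pushing an atomic rule
  behind a decreasing one leaves one decreasing step and at most one atomic step. For duplication
  the bound has to sit on the duplicating side: a rule applied below a node that is duplicated later
  must be carried out in every copy, and the number of copies is unlimited. Hence \<open>dup\<close>
  has to absorb all that pulling back can produce: a child gets any positive number of copies, and
  each copy is again, independently, a \<open>dup\<close> of that child. Its reflexive-transitive
  closure is that of \<open>Pi_plus\<close>, and the final argument looks at closures only. Only
  \<open>Sigma\<close> is to become invisible, and it permutes children, never variables; so the
  variables stay a list.\<close>

datatype 'v bag_tree = Node "'v list" "(nat \<times> 'v bag_tree) multiset"

text \<open>Matching with \<open>add_mset\<close> replaces indices, and the context rule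
  \<open>child\<close> replaces positions. Overlaps of two steps thus become equations between
  multisets, which \<open>add_eq_conv_ex\<close> splits into finitely many cases.\<close>

inductive bstep :: "trc_rule \<Rightarrow> 'v bag_tree \<Rightarrow> 'v bag_tree \<Rightarrow> bool" where
  rho_plus: "valid_index i \<Delta> \<Longrightarrow> bstep Rho_plus (Node \<Delta> G) (Node (duplicate_at \<Delta> i) G)"
| rho_minus: "valid_index i \<Delta> \<Longrightarrow> bstep Rho_minus (Node \<Delta> G) (Node (delete_at \<Delta> i) G)"
| pi_plus: "bstep Pi_plus (Node \<Delta> (add_mset x G)) (Node \<Delta> (add_mset x (add_mset x G)))"
| pi_minus: "bstep Pi_minus (Node \<Delta> (add_mset x G)) (Node \<Delta> G)"
| four: "bstep Four (Node \<Delta> (add_mset (\<beta>, Node \<Delta>' (add_mset (\<beta>, S) G')) G))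
    (Node \<Delta> (add_mset (\<beta>, S) G))"
| lambda: "\<alpha> > \<beta> \<Longrightarrow> bstep Lambda (Node \<Delta> (add_mset (\<alpha>, S) G)) (Node \<Delta> (add_mset (\<beta>, S) G))"
| j: "\<alpha> > \<beta> \<Longrightarrow> bstep J (Node \<Delta> (add_mset (\<alpha>, Node \<Delta>' G') (add_mset (\<beta>, S) G)))
    (Node \<Delta> (add_mset (\<alpha>, Node \<Delta>' (add_mset (\<beta>, S) G')) G))"
| child: "bstep \<mu> X Y \<Longrightarrow> bstep \<mu> (Node \<Delta> (add_mset (\<alpha>, X) G)) (Node \<Delta> (add_mset (\<alpha>, Y) G))"

text \<open>What \<open>J\<close> does to the absorbing node, available for a tree whose root need
  not be split open.\<close>

fun add_child :: "nat \<times> 'v bag_tree \<Rightarrow> 'v bag_tree \<Rightarrow> 'v bag_tree" where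
  "add_child z (Node \<Delta> G) = Node \<Delta> (add_mset z G)"

text \<open>Rules are local: each one touches a few children at a node, so a spare child at the root
  only enlarges the untouched rest.\<close>

lemma bstep_add_child: "bstep \<mu> X Y \<Longrightarrow> bstep \<mu> (add_child z X) (add_child z Y)"
proof (induction rule: bstep.induct)
  case (pi_plus \<Delta> x G)
  then show ?case
    using bstep.pi_plus[of \<Delta> x "add_mset z G"] by (simp add: add_mset_commute[of _ z])
next
  case (pi_minus \<Delta> x G)
  then show ?case
    using bstep.pi_minus[of \<Delta> x "add_mset z G"] by (simp add: add_mset_commute[of _ z])
next
  case (four \<Delta> \<beta> \<Delta>' S G' G)
  then show ?case
    using bstep.four[of \<Delta> \<beta> \<Delta>' S G' "add_mset z G"] by (simp add: add_mset_commute[of _ z])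
next
  case (lambda \<alpha> \<beta> \<Delta> S G)
  then show ?case
    using bstep.lambda[of \<beta> \<alpha> \<Delta> S "add_mset z G"] by (simp add: add_mset_commute[of _ z])
next
  case (j \<alpha> \<beta> \<Delta> \<Delta>' G' S G)
  then show ?case
    using bstep.j[of \<beta> \<alpha> \<Delta> \<Delta>' G' S "add_mset z G"] by (simp add: add_mset_commute[of _ z])
next
  case (child \<mu> X Y \<Delta> \<alpha> G)
  then show ?case
    using bstep.child[of \<mu> X Y \<Delta> \<alpha> "add_mset z G"] by (simp add: add_mset_commute[of _ z])
qed (auto intro: bstep.intros)

lemma bstep_add_mset:
  "bstep \<mu> (Node \<Delta> G) (Node \<Delta>' H) \<Longrightarrow> bstep \<mu> (Node \<Delta> (add_mset z G)) (Node \<Delta>' (add_mset z H))"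
  using bstep_add_child by fastforce

lemma bsteps_add_child: "(bstep \<mu>)\<^sup>*\<^sup>* X Y \<Longrightarrow> (bstep \<mu>)\<^sup>*\<^sup>* (add_child z X) (add_child z Y)"
  by (induction rule: rtranclp_induct) (auto intro: bstep_add_child rtranclp.rtrancl_into_rtrancl)

lemma bsteps_add_mset:
  "(bstep \<mu>)\<^sup>*\<^sup>* (Node \<Delta> G) (Node \<Delta>' H) \<Longrightarrow>
   (bstep \<mu>)\<^sup>*\<^sup>* (Node \<Delta> (add_mset z G)) (Node \<Delta>' (add_mset z H))"
  using bsteps_add_child by fastforce

lemma bsteps_child:
  "(bstep \<mu>)\<^sup>*\<^sup>* X Y \<Longrightarrow>
   (bstep \<mu>)\<^sup>*\<^sup>* (Node \<Delta> (add_mset (\<alpha>, X) G)) (Node \<Delta> (add_mset (\<alpha>, Y) G))"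
  by (induction rule: rtranclp_induct) (auto intro: bstep.child rtranclp.rtrancl_into_rtrancl)

text \<open>The non-atomic rules neither read nor write the variables at the root.\<close>

lemma bstep_change_variables:
  assumes "bstep \<mu> (Node \<Delta> G) (Node \<Delta>' H)" "\<mu> \<notin> atomic_rules"
  shows "\<Delta>' = \<Delta> \<and> bstep \<mu> (Node \<Delta>'' G) (Node \<Delta>'' H)"
  using assms by (cases rule: bstep.cases) (auto simp: atomic_rules_def intro: bstep.intros)


section \<open>Parallel duplication\<close>

text \<open>\<open>single\<close> accounts for a child together with one of its copies, so no child
  can vanish; \<open>more\<close> adds a further copy of a child already accounted for.\<close>

inductive dup :: "'v bag_tree \<Rightarrow> 'v bag_tree \<Rightarrow> bool"
  and dups :: "(nat \<times> 'v bag_tree) multiset \<Rightarrow> (nat \<times> 'v bag_tree) multiset \<Rightarrow> bool" where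
  node: "dups G H \<Longrightarrow> dup (Node \<Delta> G) (Node \<Delta> H)"
| empty: "dups {#} {#}"
| single: "dup X Y \<Longrightarrow> dups G H \<Longrightarrow> dups (add_mset (\<alpha>, X) G) (add_mset (\<alpha>, Y) H)"
| more: "(\<alpha>, X) \<in># G \<Longrightarrow> dup X Y \<Longrightarrow> dups G H \<Longrightarrow> dups G (add_mset (\<alpha>, Y) H)"

inductive_cases dup_NodeE: "dup (Node \<Delta> G) Y"

text \<open>The bags that may take the place of a child in a parallel duplication; being nonempty
  keeps duplication from deleting.\<close>

definition copies :: "nat \<Rightarrow> 'v bag_tree \<Rightarrow> (nat \<times> 'v bag_tree) multiset \<Rightarrow> bool" where
  "copies \<alpha> X K \<longleftrightarrow> K \<noteq> {#} \<and> (\<forall>y\<in>#K. \<exists>Y. y = (\<alpha>, Y) \<and> dup X Y)"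

lemma copies_union: "copies \<alpha> X K \<Longrightarrow> copies \<alpha> X L \<Longrightarrow> copies \<alpha> X (K + L)"
  by (auto simp: copies_def)

lemma copies_single: "dup X Y \<Longrightarrow> copies \<alpha> X {#(\<alpha>, Y)#}"
  by (auto simp: copies_def)

lemma dups_add_copies:
  assumes "copies \<alpha> X K" "dups G H"
  shows "dups (add_mset (\<alpha>, X) G) (K + H)"
proof -
  have "K \<noteq> {#} \<Longrightarrow> \<forall>y\<in>#K. \<exists>Y. y = (\<alpha>, Y) \<and> dup X Y \<Longrightarrow> ?thesis"
  proof (induction K)
    case empty
    then show ?case by simp
  next
    case (add y K)
    then obtain Y where "y = (\<alpha>, Y)" "dup X Y" by auto
    then show ?case
      using add assms(2) by (cases "K = {#}") (auto intro: dup_dups.intros)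
  qed
  then show ?thesis using assms(1) by (simp add: copies_def)
qed

text \<open>Plain rule inversion is too weak, because the copies of \<open>X\<close> may enter at
  any stage of the derivation, interleaved with copies of other children. Induction on the
  derivation collects them.\<close>

lemma dups_addE:
  assumes "dups (add_mset (\<alpha>, X) G) H"
  obtains K H' where "H = K + H'" "copies \<alpha> X K" "dups G H'"
proof -
  have "\<forall>G. L = add_mset (\<alpha>, X) G \<longrightarrow> (\<exists>K H'. H = K + H' \<and> copies \<alpha> X K \<and> dups G H')"
    if "dups L H" for L
    using that
  proof (induction rule: dup_dups.inducts(2)[where ?P1.0 = "\<lambda>_ _. True"])
    case (single X' Y L H \<alpha>')
    show ?case
    proof (intro allI impI)
      fix G assume "add_mset (\<alpha>', X') L = add_mset (\<alpha>, X) G"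
      then consider "\<alpha>' = \<alpha>" "X' = X" "L = G"
        | M where "L = add_mset (\<alpha>, X) M" "G = add_mset (\<alpha>', X') M"
        by (auto simp: add_eq_conv_ex)
      then show "\<exists>K H'. add_mset (\<alpha>', Y) H = K + H' \<and> copies \<alpha> X K \<and> dups G H'"
      proof cases
        case 1
        with single show ?thesis
          by (metis add_mset_add_single copies_single union_commute)
      next
        case 2
        with single obtain K H' where "H = K + H'" "copies \<alpha> X K" "dups M H'" by blast
        with single 2 show ?thesis
          by (metis dup_dups.single union_mset_add_mset_right)
      qed
    qed
  next
    case (more \<alpha>' X' L Y H)
    show ?case
    proof (intro allI impI)
      fix G assume L: "L = add_mset (\<alpha>, X) G"
      with more obtain K H' where K: "H = K + H'" "copies \<alpha> X K" "dups G H'" by blast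
      show "\<exists>K H'. add_mset (\<alpha>', Y) H = K + H' \<and> copies \<alpha> X K \<and> dups G H'"
      \<comment> \<open>A copy whose original also occurs in \<open>G\<close> is credited to
        \<open>G\<close>, where the membership premise of \<open>more\<close> still holds. Otherwise
        the original can only be the distinguished child.\<close>
      proof (cases "(\<alpha>', X') \<in># G")
        case True
        with K more show ?thesis
          by (metis dup_dups.more union_mset_add_mset_right)
      next
        case False
        with L more have "\<alpha>' = \<alpha>" "X' = X" by auto
        with K more have "add_mset (\<alpha>', Y) H = add_mset (\<alpha>, Y) K + H'"
          "copies \<alpha> X (add_mset (\<alpha>, Y) K)" by (auto simp: copies_def)
        with K show ?thesis by blast
      qed
    qed
  qed auto
  with assms that show thesis by blast
qed

lemma dup_refl: "dup X X"
proof (induction X)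
  case (Node \<Delta> G)
  have "\<forall>x\<in>#H. dup (snd x) (snd x) \<Longrightarrow> dups H H" for H :: "(nat \<times> 'a bag_tree) multiset"
    by (induction H) (auto intro: dup_dups.intros)
  moreover have "\<forall>x\<in>#G. dup (snd x) (snd x)"
    using Node by auto
  ultimately show ?case by (blast intro: dup_dups.node)
qed

lemma dups_refl: "dups G G"
  using dup_refl[of "Node [] G"] by (auto elim: dup_NodeE)

lemma bstep_pi_plus_imp_dup: "bstep Pi_plus X Y \<Longrightarrow> dup X Y"
proof (induction Pi_plus X Y rule: bstep.induct)
  case (pi_plus \<Delta> x G)
  then show ?case
    by (cases x) (auto intro!: dup_dups.node intro: dup_dups.more dup_refl dups_refl)
qed (auto intro: dup_dups.intros dups_refl)

lemma dup_imp_bsteps_pi_plus: "dup X Y \<Longrightarrow> (bstep Pi_plus)\<^sup>*\<^sup>* X Y"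
proof (induction rule: dup_dups.inducts(1)[where
      ?P2.0 = "\<lambda>G H. \<forall>\<Delta>. (bstep Pi_plus)\<^sup>*\<^sup>* (Node \<Delta> G) (Node \<Delta> H)"])
  case (single X Y G H \<alpha>)
  then show ?case
    by (meson bsteps_add_mset bsteps_child rtranclp_trans)
next
  case (more \<alpha> X G Y H)
  show ?case
  proof
    fix \<Delta>
    \<comment> \<open>Duplication at this node comes first, while the child is still
      \<open>X\<close>. Then one occurrence evolves to \<open>Y\<close>, and the original bag
      \<open>G\<close> independently to \<open>H\<close>.\<close>
    obtain G' where "G = add_mset (\<alpha>, X) G'" using more by (meson multi_member_split)
    then have "bstep Pi_plus (Node \<Delta> G) (Node \<Delta> (add_mset (\<alpha>, X) G))"
      by (auto intro: bstep.intros)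
    also have "(bstep Pi_plus)\<^sup>*\<^sup>* (Node \<Delta> (add_mset (\<alpha>, X) G)) (Node \<Delta> (add_mset (\<alpha>, X) H))"
      using more by (auto intro: bsteps_add_mset)
    also have "(bstep Pi_plus)\<^sup>*\<^sup>* (Node \<Delta> (add_mset (\<alpha>, X) H)) (Node \<Delta> (add_mset (\<alpha>, Y) H))"
      using more by (auto intro: bsteps_child)
    finally show "(bstep Pi_plus)\<^sup>*\<^sup>* (Node \<Delta> G) (Node \<Delta> (add_mset (\<alpha>, Y) H))" .
  qed
qed auto

text \<open>The elements of \<open>K\<close> do not interact, and each is produced in an arbitrary
  context \<open>G\<close>, so their pre-images can be put side by side and treated one after the
  other. \<open>Q\<close> is kept abstract because \<open>J\<close> needs a bag made of two kinds of
  copies.\<close>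

lemma bsteps_replace_all:
  assumes "K \<noteq> {#}"
    and "\<And>y. y \<in># K \<Longrightarrow>
      \<exists>Z. Q Z \<and> (\<forall>G. (bstep \<mu>)\<^sup>*\<^sup>* (Node \<Delta> (Z + G)) (Node \<Delta> (add_mset y G)))"
    and Q: "\<And>Z1 Z2. Q Z1 \<Longrightarrow> Q Z2 \<Longrightarrow> Q (Z1 + Z2)"
  shows "\<exists>Z. Q Z \<and> (\<forall>G. (bstep \<mu>)\<^sup>*\<^sup>* (Node \<Delta> (Z + G)) (Node \<Delta> (K + G)))"
  using assms(1,2)
proof (induction K)
  case empty
  then show ?case by simp
next
  case (add y K)
  obtain Z where Z: "Q Z" "\<And>G. (bstep \<mu>)\<^sup>*\<^sup>* (Node \<Delta> (Z + G)) (Node \<Delta> (add_mset y G))"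
    using add.prems(2)[of y] by auto
  show ?case
  proof (cases "K = {#}")
    case True
    with Z show ?thesis by auto
  next
    case False
    then obtain Z' where Z': "Q Z'" "\<And>G. (bstep \<mu>)\<^sup>*\<^sup>* (Node \<Delta> (Z' + G)) (Node \<Delta> (K + G))"
      using add.IH add.prems by (metis insert_iff set_mset_add_mset_insert)
    have "(bstep \<mu>)\<^sup>*\<^sup>* (Node \<Delta> ((Z + Z') + G)) (Node \<Delta> (add_mset y K + G))" for G
    proof -
      have "(bstep \<mu>)\<^sup>*\<^sup>* (Node \<Delta> ((Z + Z') + G)) (Node \<Delta> (add_mset y (Z' + G)))"
        using Z(2)[of "Z' + G"] by (simp add: add.assoc)
      also have "(bstep \<mu>)\<^sup>*\<^sup>* \<dots> (Node \<Delta> (add_mset y (K + G)))"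
        using Z' by (auto intro: bsteps_add_mset)
      finally show ?thesis by simp
    qed
    with Q[OF Z(1) Z'(1)] show ?thesis by blast
  qed
qed

text \<open>The common pattern of the rules \<open>four\<close>, \<open>lambda\<close> and
  \<open>child\<close>, which turn one child into one child: it suffices to pull back a single copy
  of the new child.\<close>

lemma dups_replace_copies:
  assumes "copies \<beta> Y K" "dups G H"
    and "\<And>Y'. dup Y Y' \<Longrightarrow>
      \<exists>Z. copies \<alpha> X Z \<and> (\<forall>G. (bstep \<mu>)\<^sup>*\<^sup>* (Node \<Delta> (Z + G)) (Node \<Delta> (add_mset (\<beta>, Y') G)))"
  shows "\<exists>A. dup (Node \<Delta> (add_mset (\<alpha>, X) G)) A \<and> (bstep \<mu>)\<^sup>*\<^sup>* A (Node \<Delta> (K + H))"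
proof -
  have "\<exists>Z. copies \<alpha> X Z \<and> (\<forall>G. (bstep \<mu>)\<^sup>*\<^sup>* (Node \<Delta> (Z + G)) (Node \<Delta> (K + G)))"
    using assms(1,3) by (intro bsteps_replace_all copies_union) (auto simp: copies_def)
  with assms(2) show ?thesis
    by (meson dup_dups.node dups_add_copies)
qed

text \<open>When the absorbed sibling is duplicated inside the absorbing node, its place is taken by
  a bag of copies, each of which costs its own \<open>J\<close> step.\<close>

lemma bsteps_j_absorb:
  assumes "\<forall>y\<in>#K. fst y < \<alpha>"
  shows "(bstep J)\<^sup>*\<^sup>* (Node \<Delta> (add_mset (\<alpha>, Node \<Delta>' H) (K + G)))
    (Node \<Delta> (add_mset (\<alpha>, Node \<Delta>' (K + H)) G))"
  using assms
proof (induction K arbitrary: H)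
  case (add y K)
  obtain \<beta> S where y: "y = (\<beta>, S)" by fastforce
  have "bstep J (Node \<Delta> (add_mset (\<alpha>, Node \<Delta>' H) (add_mset y (K + G))))
    (Node \<Delta> (add_mset (\<alpha>, Node \<Delta>' (add_mset y H)) (K + G)))"
    using add.prems unfolding y by (intro bstep.j) simp
  also have "(bstep J)\<^sup>*\<^sup>* \<dots> (Node \<Delta> (add_mset (\<alpha>, Node \<Delta>' (K + add_mset y H)) G))"
    using add.IH[of "add_mset y H"] add.prems by simp
  finally show ?case by simp
qed simp

text \<open>The rule is repeated once for each copy of the place where it acted, while the
  duplication stays a single \<open>dup\<close>. This one-sidedness is what
  \<open>postponableI_left\<close> requires.\<close>

lemma bstep_dup_commute:
  assumes "bstep \<mu> A B" "\<mu> \<noteq> Pi_plus" "dup B C"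
  shows "\<exists>A'. dup A A' \<and> (bstep \<mu>)\<^sup>*\<^sup>* A' C"
  using assms
proof (induction arbitrary: C rule: bstep.induct)
  case (rho_plus i \<Delta> G)
  then obtain H where "C = Node (duplicate_at \<Delta> i) H" "dups G H" by (auto elim: dup_NodeE)
  then show ?case
    using bstep.rho_plus[OF rho_plus(1)] by (blast intro: dup_dups.node)
next
  case (rho_minus i \<Delta> G)
  then obtain H where "C = Node (delete_at \<Delta> i) H" "dups G H" by (auto elim: dup_NodeE)
  then show ?case
    using bstep.rho_minus[OF rho_minus(1)] by (blast intro: dup_dups.node)
next
  case (pi_minus \<Delta> x G)
  then obtain H where C: "C = Node \<Delta> H" "dups G H" by (auto elim: dup_NodeE)
  \<comment> \<open>The child that is about to be deleted is carried along without
    duplication.\<close>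
  then have "dup (Node \<Delta> (add_mset x G)) (Node \<Delta> (add_mset x H))"
    by (cases x) (auto intro: dup_dups.intros dup_refl)
  then show ?case
    using C bstep.pi_minus by blast
next
  case (four \<Delta> \<beta> \<Delta>' S G' G)
  then obtain K H where C: "C = Node \<Delta> (K + H)" "copies \<beta> S K" "dups G H"
    by (metis dup_NodeE dups_addE)
  show ?case
    unfolding C
  proof (rule dups_replace_copies[OF C(2,3)])
    fix S' assume "dup S S'"
    \<comment> \<open>Each copy of \<open>S\<close> receives its own copy of the node from which it
      is lifted, and inside that node only \<open>S\<close> has changed.\<close>
    then have "copies \<beta> (Node \<Delta>' (add_mset (\<beta>, S) G')) {#(\<beta>, Node \<Delta>' (add_mset (\<beta>, S') G'))#}"
      by (auto intro!: copies_single dup_dups.node dup_dups.single dups_refl)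
    then show "\<exists>Z. copies \<beta> (Node \<Delta>' (add_mset (\<beta>, S) G')) Z \<and>
      (\<forall>G. (bstep Four)\<^sup>*\<^sup>* (Node \<Delta> (Z + G)) (Node \<Delta> (add_mset (\<beta>, S') G)))"
      by (intro exI conjI) (auto intro!: r_into_rtranclp bstep.four)
  qed
next
  case (lambda \<alpha> \<beta> \<Delta> S G)
  then obtain K H where C: "C = Node \<Delta> (K + H)" "copies \<beta> S K" "dups G H"
    by (metis dup_NodeE dups_addE)
  show ?case
    unfolding C
  proof (rule dups_replace_copies[OF C(2,3)])
    fix S' assume "dup S S'"
    then have "copies \<alpha> S {#(\<alpha>, S')#}" by (rule copies_single)
    then show "\<exists>Z. copies \<alpha> S Z \<and>
      (\<forall>G. (bstep Lambda)\<^sup>*\<^sup>* (Node \<Delta> (Z + G)) (Node \<Delta> (add_mset (\<beta>, S') G)))"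
      using lambda by (intro exI conjI) (auto intro!: r_into_rtranclp bstep.lambda)
  qed
next
  case (j \<alpha> \<beta> \<Delta> \<Delta>' G' S G)
  then obtain K H where C: "C = Node \<Delta> (K + H)"
    "copies \<alpha> (Node \<Delta>' (add_mset (\<beta>, S) G')) K" "dups G H"
    by (metis dup_NodeE dups_addE)
  \<comment> \<open>A copy of the merged node comes from one copy of the absorbing node together
    with the bag of copies of \<open>S\<close> found inside it. Over all of \<open>K\<close> these
    add up to two nonempty bags, one replacing each of the two siblings.\<close>
  define Q where "Q Z \<longleftrightarrow> (\<exists>Z1 Z2. Z = Z1 + Z2 \<and> copies \<alpha> (Node \<Delta>' G') Z1 \<and> copies \<beta> S Z2)" for Z
  have "\<exists>Z. Q Z \<and> (\<forall>G. (bstep J)\<^sup>*\<^sup>* (Node \<Delta> (Z + G)) (Node \<Delta> (K + G)))"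
  proof (rule bsteps_replace_all)
    show "K \<noteq> {#}" using C by (simp add: copies_def)
  next
    fix y assume "y \<in># K"
    then obtain Y where "y = (\<alpha>, Y)" "dup (Node \<Delta>' (add_mset (\<beta>, S) G')) Y"
      using C by (auto simp: copies_def)
    then obtain L H' where y: "y = (\<alpha>, Node \<Delta>' (L + H'))" "copies \<beta> S L" "dups G' H'"
      by (metis dup_NodeE dups_addE)
    then have "Q ({#(\<alpha>, Node \<Delta>' H')#} + L)"
      unfolding Q_def by (blast intro: copies_single dup_dups.node)
    moreover have "\<forall>y\<in>#L. fst y < \<alpha>" using y j by (auto simp: copies_def)
    ultimately show "\<exists>Z. Q Z \<and> (\<forall>G. (bstep J)\<^sup>*\<^sup>* (Node \<Delta> (Z + G)) (Node \<Delta> (add_mset y G)))"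
      unfolding y using bsteps_j_absorb by (intro exI conjI) auto
  next
    fix Z1 Z2 assume "Q Z1" "Q Z2"
    then obtain L1 L2 L3 L4 where "Z1 = L1 + L2" "Z2 = L3 + L4" "copies \<alpha> (Node \<Delta>' G') L1"
      "copies \<beta> S L2" "copies \<alpha> (Node \<Delta>' G') L3" "copies \<beta> S L4"
      unfolding Q_def by blast
    then show "Q (Z1 + Z2)"
      unfolding Q_def by (intro exI[of _ "L1 + L3"] exI[of _ "L2 + L4"]) (auto intro: copies_union)
  qed
  then obtain Z1 Z2 where Z: "copies \<alpha> (Node \<Delta>' G') Z1" "copies \<beta> S Z2"
    "\<And>G. (bstep J)\<^sup>*\<^sup>* (Node \<Delta> (Z1 + Z2 + G)) (Node \<Delta> (K + G))"
    unfolding Q_def by auto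
  have "dups (add_mset (\<alpha>, Node \<Delta>' G') (add_mset (\<beta>, S) G)) (Z1 + (Z2 + H))"
    using Z C by (intro dups_add_copies)
  then show ?case
    using Z(3)[of H] unfolding C by (auto simp: add.assoc intro: dup_dups.node)
next
  case (child \<mu> X Y \<Delta> \<alpha> G)
  then obtain K H where C: "C = Node \<Delta> (K + H)" "copies \<alpha> Y K" "dups G H"
    by (metis dup_NodeE dups_addE)
  show ?case
    unfolding C
  proof (rule dups_replace_copies[OF C(2,3)])
    fix Y' assume "dup Y Y'"
    then obtain X' where "dup X X'" "(bstep \<mu>)\<^sup>*\<^sup>* X' Y'" using child by blast
    then show "\<exists>Z. copies \<alpha> X Z \<and>
      (\<forall>G. (bstep \<mu>)\<^sup>*\<^sup>* (Node \<Delta> (Z + G)) (Node \<Delta> (add_mset (\<alpha>, Y') G)))"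
      by (intro exI[of _ "{#(\<alpha>, X')#}"]) (auto intro: copies_single bsteps_child)
  qed
qed auto

section \<open>Commutation of the rules\<close>

lemma bstep_j_add_child:
  "\<alpha> > \<beta> \<Longrightarrow> bstep J (Node \<Delta> (add_mset (\<alpha>, X) (add_mset (\<beta>, S) G)))
    (Node \<Delta> (add_mset (\<alpha>, add_child (\<beta>, S) X) G))"
  by (cases X) (auto intro: bstep.j)

lemma bstep_j_add_child_snd:
  "\<alpha> > \<beta> \<Longrightarrow> bstep J (Node \<Delta> (add_mset (\<beta>, S) (add_mset (\<alpha>, X) G)))
    (Node \<Delta> (add_mset (\<alpha>, add_child (\<beta>, S) X) G))"
  using bstep_j_add_child by (metis add_mset_commute)

text \<open>In the exchanges below, the first step has just produced or changed the child
  \<open>(\<alpha>, Y)\<close>. What matters is how the second step uses it: not at all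
  (\<open>rest\<close>), as the child that is deleted, lifted from, relabelled, absorbing or
  absorbed, or as the context of a deeper step.\<close>

lemma bstep_Node_addE:
  assumes "bstep \<mu> (Node \<Delta> (add_mset (\<alpha>, Y) G)) C" "\<mu> \<in> modal_rules \<union> decreasing_rules"
  obtains (rest) H where "bstep \<mu> (Node \<Delta> G) (Node \<Delta> H)" "C = Node \<Delta> (add_mset (\<alpha>, Y) H)"
  | (pi_minus) "\<mu> = Pi_minus" "C = Node \<Delta> G"
  | (four) \<Delta>' S G' where "\<mu> = Four" "Y = Node \<Delta>' (add_mset (\<alpha>, S) G')"
      "C = Node \<Delta> (add_mset (\<alpha>, S) G)"
  | (lambda) \<beta> where "\<mu> = Lambda" "\<beta> < \<alpha>" "C = Node \<Delta> (add_mset (\<beta>, Y) G)"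
  | (j_into) \<beta> S G' where "\<mu> = J" "\<beta> < \<alpha>" "G = add_mset (\<beta>, S) G'"
      "C = Node \<Delta> (add_mset (\<alpha>, add_child (\<beta>, S) Y) G')"
  | (j_from) \<beta> X G' where "\<mu> = J" "\<alpha> < \<beta>" "G = add_mset (\<beta>, X) G'"
      "C = Node \<Delta> (add_mset (\<beta>, add_child (\<alpha>, Y) X) G')"
  | (child) Z where "bstep \<mu> Y Z" "C = Node \<Delta> (add_mset (\<alpha>, Z) G)"
  using assms(1)
proof (cases rule: bstep.cases)
  case (rho_plus i)
  with assms(2) show ?thesis by (simp add: modal_rules_def decreasing_rules_def)
next
  case (rho_minus i)
  with assms(2) show ?thesis by (simp add: modal_rules_def decreasing_rules_def)
next
  case (pi_plus x G)
  with assms(2) show ?thesis by (simp add: modal_rules_def decreasing_rules_def)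
next
  case (pi_minus x G1)
  then consider "G = G1" | M where "G = add_mset x M" "G1 = add_mset (\<alpha>, Y) M"
    by (auto simp: add_eq_conv_ex)
  then show ?thesis
  proof cases
    case 1
    with pi_minus that(2) show ?thesis by auto
  next
    case 2
    with pi_minus that(1)[of M] bstep.pi_minus[of \<Delta> x M] show ?thesis by auto
  qed
next
  case (four \<beta> \<Delta>' S G' G1)
  then consider "\<beta> = \<alpha>" "Y = Node \<Delta>' (add_mset (\<beta>, S) G')" "G = G1"
    | M where "G = add_mset (\<beta>, Node \<Delta>' (add_mset (\<beta>, S) G')) M" "G1 = add_mset (\<alpha>, Y) M"
    by (auto simp: add_eq_conv_ex)
  then show ?thesis
  proof cases
    case 1
    with four that(3) show ?thesis by auto
  next
    case 2
    with four that(1)[of "add_mset (\<beta>, S) M"] bstep.four[of \<Delta> \<beta> \<Delta>' S G' M] show ?thesis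
      by (auto simp: add_mset_commute)
  qed
next
  case (lambda \<gamma> \<beta> S G1)
  then consider "\<gamma> = \<alpha>" "S = Y" "G = G1"
    | M where "G = add_mset (\<gamma>, S) M" "G1 = add_mset (\<alpha>, Y) M"
    by (auto simp: add_eq_conv_ex)
  then show ?thesis
  proof cases
    case 1
    with lambda that(4) show ?thesis by auto
  next
    case 2
    with lambda that(1)[of "add_mset (\<beta>, S) M"] bstep.lambda[of \<beta> \<gamma> \<Delta> S M] show ?thesis
      by (auto simp: add_mset_commute)
  qed
next
  case (j \<gamma> \<beta> \<Delta>' G' S G1)
  then consider "\<gamma> = \<alpha>" "Y = Node \<Delta>' G'" "G = add_mset (\<beta>, S) G1"
    | "\<beta> = \<alpha>" "S = Y" "G = add_mset (\<gamma>, Node \<Delta>' G') G1"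
    | M where "G = add_mset (\<gamma>, Node \<Delta>' G') (add_mset (\<beta>, S) M)" "G1 = add_mset (\<alpha>, Y) M"
    by (auto simp: add_eq_conv_ex)
  then show ?thesis
  proof cases
    case 1
    with j that(5) show ?thesis by auto
  next
    case 2
    with j that(6) show ?thesis by auto
  next
    case 3
    with j that(1)[of "add_mset (\<gamma>, Node \<Delta>' (add_mset (\<beta>, S) G')) M"] bstep.j[of \<beta> \<gamma> \<Delta> \<Delta>' G' S M] show ?thesis
      by (auto simp: add_mset_commute)
  qed
next
  case (child X Z \<beta> G1)
  then consider "\<beta> = \<alpha>" "X = Y" "G = G1"
    | M where "G = add_mset (\<beta>, X) M" "G1 = add_mset (\<alpha>, Y) M"
    by (auto simp: add_eq_conv_ex)
  then show ?thesis
  proof cases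
    case 1
    with child that(7) show ?thesis by auto
  next
    case 2
    with child that(1)[of "add_mset (\<beta>, Z) M"] bstep.child[of \<mu> X Z \<Delta> \<beta> M] show ?thesis
      by (auto simp: add_mset_commute)
  qed
qed

lemma bstep_atomic_root_commute:
  assumes "bstep \<mu> (Node \<Delta>' G) C" "\<mu> \<notin> atomic_rules"
    and "\<And>H. bstep \<kappa> (Node \<Delta> H) (Node \<Delta>' H)"
  shows "\<exists>A'. bstep \<mu> (Node \<Delta> G) A' \<and> bstep \<kappa> A' C"
proof -
  obtain \<Delta>'' H where "C = Node \<Delta>'' H" by (cases C)
  with assms show ?thesis using bstep_change_variables by metis
qed

text \<open>One modal step suffices unless it relabels the subtree just lifted by
  \<open>Four\<close>, or makes it absorb a sibling. In these overlaps the modal rule is applied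
  both inside and outside the node that \<open>Four\<close> is going to discard.\<close>

lemma bstep_modal_commute:
  assumes "bstep \<kappa> A B" "\<kappa> \<in> decreasing_rules \<union> atomic_rules" "bstep \<mu> B C" "\<mu> \<in> modal_rules"
  shows "\<exists>A'. (bstep \<mu>)\<^sup>*\<^sup>* A A' \<and> bstep \<kappa> A' C"
  using assms
proof (induction arbitrary: C rule: bstep.induct)
  case (rho_plus i \<Delta> G)
  then have "\<exists>A'. bstep \<mu> (Node \<Delta> G) A' \<and> bstep Rho_plus A' C"
    by (intro bstep_atomic_root_commute)
      (auto simp: atomic_rules_def modal_rules_def intro: bstep.rho_plus)
  then show ?case by blast
next
  case (rho_minus i \<Delta> G)
  then have "\<exists>A'. bstep \<mu> (Node \<Delta> G) A' \<and> bstep Rho_minus A' C"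
    by (intro bstep_atomic_root_commute)
      (auto simp: atomic_rules_def modal_rules_def intro: bstep.rho_minus)
  then show ?case by blast
next
  case (pi_minus \<Delta> x G)
  then have "bstep \<mu> (add_child x (Node \<Delta> G)) (add_child x C)"
    by (intro bstep_add_child)
  moreover have "bstep Pi_minus (add_child x C) C"
    by (cases C) (simp add: bstep.pi_minus)
  ultimately show ?case by auto
next
  case (four \<Delta> \<beta> \<Delta>' S G' G)
  let ?A = "\<lambda>S G. Node \<Delta> (add_mset (\<beta>, Node \<Delta>' (add_mset (\<beta>, S) G')) G)"
  have "\<mu> \<in> modal_rules \<union> decreasing_rules" using four by simp
  with four(2) show ?case
  proof (cases rule: bstep_Node_addE)
    case (rest H)
    then have "bstep \<mu> (?A S G) (?A S H)" by (intro bstep_add_mset)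
    with rest show ?thesis by (blast intro: bstep.four)
  next
    case (lambda \<gamma>)
    \<comment> \<open>\<open>Four\<close> demands equal labels on the two edges, so both have to be
      lowered.\<close>
    have "(bstep Lambda)\<^sup>*\<^sup>* (?A S G) (Node \<Delta> (add_mset (\<beta>, Node \<Delta>' (add_mset (\<gamma>, S) G')) G))"
      using lambda by (intro r_into_rtranclp bstep.child bstep.lambda)
    also have "bstep Lambda \<dots> (Node \<Delta> (add_mset (\<gamma>, Node \<Delta>' (add_mset (\<gamma>, S) G')) G))"
      using lambda by (intro bstep.lambda)
    finally show ?thesis
      unfolding lambda by (blast intro: bstep.four)
  next
    case (j_into \<gamma> U G1)
    \<comment> \<open>The sibling \<open>U\<close> travels down in two steps, first into the
      intermediate node and then into \<open>S\<close>. Both edges on the way carry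
      \<open>\<beta>\<close>, which exceeds \<open>\<gamma>\<close>.\<close>
    have "(bstep J)\<^sup>*\<^sup>* (?A S G)
      (Node \<Delta> (add_mset (\<beta>, Node \<Delta>' (add_mset (\<beta>, S) (add_mset (\<gamma>, U) G'))) G1))"
      using bstep.j[of \<gamma> \<beta> \<Delta> \<Delta>' "add_mset (\<beta>, S) G'" U G1] j_into
      by (auto simp: add_mset_commute)
    also have "bstep J \<dots> (?A (add_child (\<gamma>, U) S) G1)"
      using j_into by (intro bstep.child bstep_j_add_child)
    finally show ?thesis
      unfolding j_into by (blast intro: bstep.four)
  next
    case (j_from \<gamma> X G1)
    obtain \<Delta>'' H where X: "X = Node \<Delta>'' H" by (cases X)
    \<comment> \<open>Here the whole unlifted node is absorbed by \<open>X\<close>, and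
      \<open>Four\<close> is applied afterwards one level deeper.\<close>
    let ?B = "Node \<Delta> (add_mset (\<gamma>, add_child (\<beta>, Node \<Delta>' (add_mset (\<beta>, S) G')) X) G1)"
    have "bstep J (?A S G) ?B"
      unfolding j_from using j_from(2) by (rule bstep_j_add_child_snd)
    moreover have "bstep Four ?B C"
      unfolding j_from X by (auto intro: bstep.child bstep.four)
    ultimately show ?thesis using j_from by blast
  next
    case (child Z)
    then have "bstep \<mu> (?A S G) (?A Z G)" by (intro bstep.child)
    with child show ?thesis by (blast intro: bstep.four)
  qed (use four in \<open>auto simp: modal_rules_def\<close>)
next
  case (child \<kappa> X Y \<Delta> \<alpha> G)
  have "\<mu> \<in> modal_rules \<union> decreasing_rules" using child by simp
  with \<open>bstep \<mu> (Node \<Delta> (add_mset (\<alpha>, Y) G)) C\<close> show ?case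
  proof (cases rule: bstep_Node_addE)
    case (rest H)
    with child show ?thesis by (blast intro: bstep_add_mset bstep.child)
  next
    case (lambda \<beta>)
    with child show ?thesis by (blast intro: bstep.lambda bstep.child)
  next
    case (j_into \<beta> S G')
    with child show ?thesis by (blast intro: bstep_j_add_child bstep.child bstep_add_child)
  next
    case (j_from \<beta> Z G')
    obtain \<Delta>' H where Z: "Z = Node \<Delta>' H" by (cases Z)
    let ?B = "Node \<Delta> (add_mset (\<beta>, add_child (\<alpha>, X) Z) G')"
    have "bstep J (Node \<Delta> (add_mset (\<alpha>, X) G)) ?B"
      unfolding j_from using j_from(2) by (rule bstep_j_add_child_snd)
    moreover have "bstep \<kappa> ?B C"
      unfolding j_from Z using child by (auto intro: bstep.child)
    ultimately show ?thesis using j_from by blast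
  next
    case (child Z)
    then obtain X' where "(bstep \<mu>)\<^sup>*\<^sup>* X X'" "bstep \<kappa> X' Z"
      using child.IH child.prems by blast
    with child show ?thesis by (blast intro: bsteps_child bstep.child)
  qed (use child in \<open>auto simp: modal_rules_def\<close>)
qed (auto simp: decreasing_rules_def atomic_rules_def)

text \<open>Atomic rules leave the edges alone, so every child was already there under the same
  label, and at most its variables, or those of a node below it, were changed.\<close>

lemma bstep_atomic_NodeE:
  assumes "bstep \<kappa> X (Node \<Delta> (add_mset (\<alpha>, S) G))" "\<kappa> \<in> atomic_rules"
  obtains \<Delta>' S' G' where "X = Node \<Delta>' (add_mset (\<alpha>, S') G')" "(bstep \<kappa>)\<^sup>=\<^sup>= S' S"
  using assms(1)
proof (cases rule: bstep.cases)
  case (child Z Z' \<beta> G1)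
  then consider "\<beta> = \<alpha>" "Z' = S" | M where "G1 = add_mset (\<alpha>, S) M"
    by (auto simp: add_eq_conv_ex)
  then show ?thesis
    by cases (use child that in \<open>auto simp: add_mset_commute\<close>)
qed (use assms that in \<open>auto simp: atomic_rules_def\<close>)

lemma bstep_decreasing_commute:
  assumes "bstep \<kappa> A B" "\<kappa> \<in> atomic_rules" "bstep \<mu> B C" "\<mu> \<in> decreasing_rules"
  shows "\<exists>A'. bstep \<mu> A A' \<and> (bstep \<kappa>)\<^sup>=\<^sup>= A' C"
  using assms
proof (induction arbitrary: C rule: bstep.induct)
  case (rho_plus i \<Delta> G)
  then have "\<exists>A'. bstep \<mu> (Node \<Delta> G) A' \<and> bstep Rho_plus A' C"
    by (intro bstep_atomic_root_commute)
      (auto simp: atomic_rules_def decreasing_rules_def intro: bstep.rho_plus)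
  then show ?case by blast
next
  case (rho_minus i \<Delta> G)
  then have "\<exists>A'. bstep \<mu> (Node \<Delta> G) A' \<and> bstep Rho_minus A' C"
    by (intro bstep_atomic_root_commute)
      (auto simp: atomic_rules_def decreasing_rules_def intro: bstep.rho_minus)
  then show ?case by blast
next
  case (child \<kappa> X Y \<Delta> \<alpha> G)
  have "\<mu> \<in> modal_rules \<union> decreasing_rules" using child by simp
  with \<open>bstep \<mu> (Node \<Delta> (add_mset (\<alpha>, Y) G)) C\<close> show ?case
  proof (cases rule: bstep_Node_addE)
    case (rest H)
    with child show ?thesis by (blast intro: bstep_add_mset bstep.child)
  next
    case pi_minus
    then show ?thesis by (blast intro: bstep.pi_minus)
  next
    case (four \<Delta>' S G')
    \<comment> \<open>\<open>Four\<close> keeps only \<open>S\<close> of this node; an atomic step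
      at the node itself or in another child of it disappears.\<close>
    then obtain \<Delta>'' S' G'' where "X = Node \<Delta>'' (add_mset (\<alpha>, S') G'')" "(bstep \<kappa>)\<^sup>=\<^sup>= S' S"
      using child bstep_atomic_NodeE by metis
    with four show ?thesis by (blast intro: bstep.four bstep.child)
  next
    case (child Z)
    then obtain X' where "bstep \<mu> X X'" "(bstep \<kappa>)\<^sup>=\<^sup>= X' Z"
      using child.IH child.prems by blast
    with child show ?thesis by (blast intro: bstep.child)
  qed (use child in \<open>auto simp: decreasing_rules_def\<close>)
qed (auto simp: atomic_rules_def)

section \<open>From exchanges of single steps to the normal form of runs\<close>

definition bstep_in :: "trc_rule set \<Rightarrow> 'v bag_tree \<Rightarrow> 'v bag_tree \<Rightarrow> bool" where
  "bstep_in K A B \<longleftrightarrow> (\<exists>\<kappa>\<in>K. bstep \<kappa> A B)"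

lemma bsteps_in: "(bstep \<kappa>)\<^sup>*\<^sup>* A B \<Longrightarrow> \<kappa> \<in> K \<Longrightarrow> (bstep_in K)\<^sup>*\<^sup>* A B"
  by (erule rtranclp_mono[THEN predicate2D, rotated]) (auto simp: bstep_in_def)

text \<open>Stated for closures, so that a relation may be replaced by another one with the same
  closure, as \<open>Pi_plus\<close> is by \<open>dup\<close>.\<close>

definition postponable :: "('a \<Rightarrow> 'a \<Rightarrow> bool) \<Rightarrow> ('a \<Rightarrow> 'a \<Rightarrow> bool) \<Rightarrow> bool" where
  "postponable X Y \<longleftrightarrow> (\<forall>a b c. X\<^sup>*\<^sup>* a b \<longrightarrow> Y\<^sup>*\<^sup>* b c \<longrightarrow> (\<exists>b'. Y\<^sup>*\<^sup>* a b' \<and> X\<^sup>*\<^sup>* b' c))"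

text \<open>An \<open>X\<close> step never multiplies, so it can be pushed through an entire run of
  \<open>Y\<close> even while that run grows; a run of \<open>X\<close> is then handled one step at
  a time.\<close>

lemma postponableI_right:
  assumes "\<And>a b c. X a b \<Longrightarrow> Y b c \<Longrightarrow> \<exists>b'. Y\<^sup>*\<^sup>* a b' \<and> X\<^sup>=\<^sup>= b' c"
  shows "postponable X Y"
proof -
  have 1: "\<exists>b'. Y\<^sup>*\<^sup>* a b' \<and> X\<^sup>=\<^sup>= b' c" if "Y\<^sup>*\<^sup>* b c" "X\<^sup>=\<^sup>= a b" for a b c
    using that
  proof (induction rule: rtranclp_induct)
    case (step c d)
    then obtain b' where b': "Y\<^sup>*\<^sup>* a b'" "X\<^sup>=\<^sup>= b' c" by blast
    show ?case
    proof (cases "b' = c")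
      case True
      with b' step have "Y\<^sup>*\<^sup>* a d" by auto
      then show ?thesis by blast
    next
      case False
      with b' assms[of b' c d] step obtain b'' where "Y\<^sup>*\<^sup>* b' b''" "X\<^sup>=\<^sup>= b'' d" by auto
      with b' show ?thesis by (meson rtranclp_trans)
    qed
  qed blast
  have "\<exists>b'. Y\<^sup>*\<^sup>* a b' \<and> X\<^sup>*\<^sup>* b' c" if "X\<^sup>*\<^sup>* a b" "Y\<^sup>*\<^sup>* b c" for a b c
    using that
  proof (induction arbitrary: c rule: rtranclp_induct)
    case (step b d)
    then obtain d' where "Y\<^sup>*\<^sup>* b d'" "X\<^sup>=\<^sup>= d' c" using 1 by blast
    with step.IH obtain b' where "Y\<^sup>*\<^sup>* a b'" "X\<^sup>*\<^sup>* b' d'" by blast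
    with \<open>X\<^sup>=\<^sup>= d' c\<close> show ?case by (auto intro: rtranclp.rtrancl_into_rtrancl)
  qed blast
  then show ?thesis unfolding postponable_def by blast
qed

text \<open>The mirror image: here the \<open>Y\<close> step never multiplies and is pulled through
  an entire run of \<open>X\<close>.\<close>

lemma postponableI_left:
  assumes "\<And>a b c. X a b \<Longrightarrow> Y b c \<Longrightarrow> \<exists>b'. Y a b' \<and> X\<^sup>*\<^sup>* b' c"
  shows "postponable X Y"
proof -
  have 1: "\<exists>b'. Y a b' \<and> X\<^sup>*\<^sup>* b' c" if "X\<^sup>*\<^sup>* a b" "Y b c" for a b c
    using that
  proof (induction arbitrary: c rule: rtranclp_induct)
    case (step b d)
    then obtain d' where "Y b d'" "X\<^sup>*\<^sup>* d' c" using assms by blast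
    with step.IH show ?case by (meson rtranclp_trans)
  qed blast
  have "\<exists>b'. Y\<^sup>*\<^sup>* a b' \<and> X\<^sup>*\<^sup>* b' c" if "Y\<^sup>*\<^sup>* b c" "X\<^sup>*\<^sup>* a b" for a b c
    using that
  proof (induction rule: rtranclp_induct)
    case (step c d)
    with 1 show ?case by (meson rtranclp.rtrancl_into_rtrancl)
  qed blast
  then show ?thesis unfolding postponable_def by blast
qed

lemma postponable_replicative:
  assumes "Pi_plus \<notin> K"
  shows "postponable (bstep_in K) (bstep_in replicative_rules :: 'v bag_tree \<Rightarrow> _)"
proof -
  have "bstep_in replicative_rules = (bstep Pi_plus :: 'v bag_tree \<Rightarrow> _)"
    by (intro ext) (simp add: bstep_in_def replicative_rules_def)
  then have "(bstep_in replicative_rules)\<^sup>*\<^sup>* = (dup :: 'v bag_tree \<Rightarrow> _)\<^sup>*\<^sup>*"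
    using rtranclp_subset[of "bstep Pi_plus :: 'v bag_tree \<Rightarrow> _" dup]
    by (metis bstep_pi_plus_imp_dup dup_imp_bsteps_pi_plus predicate2I)
  moreover have "postponable (bstep_in K) (dup :: 'v bag_tree \<Rightarrow> _)"
  proof (rule postponableI_left)
    fix a b c :: "'v bag_tree" assume "bstep_in K a b" "dup b c"
    then obtain \<kappa> where "\<kappa> \<in> K" "bstep \<kappa> a b" by (auto simp: bstep_in_def)
    with assms \<open>dup b c\<close> obtain b' where "dup a b'" "(bstep \<kappa>)\<^sup>*\<^sup>* b' c"
      using bstep_dup_commute by metis
    with \<open>\<kappa> \<in> K\<close> show "\<exists>b'. dup a b' \<and> (bstep_in K)\<^sup>*\<^sup>* b' c"
      by (auto intro: bsteps_in)
  qed
  ultimately show ?thesis by (simp add: postponable_def)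
qed

lemma postponable_modal:
  assumes "K \<subseteq> decreasing_rules \<union> atomic_rules"
  shows "postponable (bstep_in K) (bstep_in modal_rules)"
proof (rule postponableI_right)
  fix a b c :: "'a bag_tree" assume "bstep_in K a b" "bstep_in modal_rules b c"
  then obtain \<kappa> \<mu> where *: "\<kappa> \<in> K" "bstep \<kappa> a b" "\<mu> \<in> modal_rules" "bstep \<mu> b c"
    by (auto simp: bstep_in_def)
  with assms obtain b' where "(bstep \<mu>)\<^sup>*\<^sup>* a b'" "bstep \<kappa> b' c"
    using bstep_modal_commute by blast
  with * show "\<exists>b'. (bstep_in modal_rules)\<^sup>*\<^sup>* a b' \<and> (bstep_in K)\<^sup>=\<^sup>= b' c"
    by (blast intro: bsteps_in bstep_in_def[THEN iffD2])
qed

lemma postponable_decreasing: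
  "postponable (bstep_in atomic_rules) (bstep_in decreasing_rules)"
proof (rule postponableI_right)
  fix a b c :: "'a bag_tree" assume "bstep_in atomic_rules a b" "bstep_in decreasing_rules b c"
  then obtain \<kappa> \<mu> where *: "\<kappa> \<in> atomic_rules" "bstep \<kappa> a b" "\<mu> \<in> decreasing_rules" "bstep \<mu> b c"
    by (auto simp: bstep_in_def)
  then obtain b' where "bstep \<mu> a b'" "(bstep \<kappa>)\<^sup>=\<^sup>= b' c"
    using bstep_decreasing_commute by blast
  with * have "(bstep_in decreasing_rules)\<^sup>*\<^sup>* a b'" "(bstep_in atomic_rules)\<^sup>=\<^sup>= b' c"
    by (auto simp: bstep_in_def intro!: r_into_rtranclp)
  then show "\<exists>b'. (bstep_in decreasing_rules)\<^sup>*\<^sup>* a b' \<and> (bstep_in atomic_rules)\<^sup>=\<^sup>= b' c"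
    by blast
qed

text \<open>A step appended to a normal run is moved to the left through all phases later than its
  own. Each of the six pairs of phases contributes one exchange.\<close>

lemma bsteps_normal_form:
  assumes "(bstep_in (- structural_rules))\<^sup>*\<^sup>* A B"
  shows "\<exists>A1 A2 A3. (bstep_in replicative_rules)\<^sup>*\<^sup>* A A1 \<and> (bstep_in modal_rules)\<^sup>*\<^sup>* A1 A2 \<and>
    (bstep_in decreasing_rules)\<^sup>*\<^sup>* A2 A3 \<and> (bstep_in atomic_rules)\<^sup>*\<^sup>* A3 B"
  using assms
proof (induction rule: rtranclp_induct)
  case base
  then show ?case by blast
next
  case (step B C)
  let ?P = "bstep_in replicative_rules" and ?M = "bstep_in modal_rules"
    and ?D = "bstep_in decreasing_rules" and ?R = "bstep_in atomic_rules"
  have P: "postponable ?M ?P" "postponable ?D ?P" "postponable ?R ?P"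
    by (auto intro!: postponable_replicative
        simp: modal_rules_def decreasing_rules_def atomic_rules_def)
  have M: "postponable ?D ?M" "postponable ?R ?M"
    by (auto intro!: postponable_modal)
  note D = postponable_decreasing
  obtain A1 A2 A3 where A: "?P\<^sup>*\<^sup>* A A1" "?M\<^sup>*\<^sup>* A1 A2" "?D\<^sup>*\<^sup>* A2 A3" "?R\<^sup>*\<^sup>* A3 B"
    using step by blast
  obtain \<mu> where \<mu>: "bstep \<mu> B C" "\<mu> \<noteq> Sigma"
    using step by (auto simp: bstep_in_def structural_rules_def)
  from \<mu>(2) have "\<mu> \<in> replicative_rules \<union> modal_rules \<union> decreasing_rules \<union> atomic_rules"
    by (cases \<mu>) (simp_all add: replicative_rules_def modal_rules_def
        decreasing_rules_def atomic_rules_def)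
  with \<mu>(1) have "?P B C \<or> ?M B C \<or> ?D B C \<or> ?R B C"
    by (auto simp: bstep_in_def)
  then consider "?P\<^sup>*\<^sup>* B C" | "?M\<^sup>*\<^sup>* B C" | "?D\<^sup>*\<^sup>* B C" | "?R\<^sup>*\<^sup>* B C"
    by blast
  then show ?case
  proof cases
    case 1
    then obtain B3 where "?P\<^sup>*\<^sup>* A3 B3" "?R\<^sup>*\<^sup>* B3 C" using P(3) A unfolding postponable_def by blast
    moreover then obtain B2 where "?P\<^sup>*\<^sup>* A2 B2" "?D\<^sup>*\<^sup>* B2 B3"
      using P(2) A unfolding postponable_def by blast
    moreover then obtain B1 where "?P\<^sup>*\<^sup>* A1 B1" "?M\<^sup>*\<^sup>* B1 B2"
      using P(1) A unfolding postponable_def by blast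
    ultimately show ?thesis using A by (meson rtranclp_trans)
  next
    case 2
    then obtain B3 where "?M\<^sup>*\<^sup>* A3 B3" "?R\<^sup>*\<^sup>* B3 C" using M(2) A unfolding postponable_def by blast
    moreover then obtain B2 where "?M\<^sup>*\<^sup>* A2 B2" "?D\<^sup>*\<^sup>* B2 B3"
      using M(1) A unfolding postponable_def by blast
    ultimately show ?thesis using A by (meson rtranclp_trans)
  next
    case 3
    then obtain B3 where "?D\<^sup>*\<^sup>* A3 B3" "?R\<^sup>*\<^sup>* B3 C" using D A unfolding postponable_def by blast
    then show ?thesis using A by (meson rtranclp_trans)
  next
    case 4
    then show ?thesis using A by (meson rtranclp_trans)
  qed
qed


section \<open>Transfer to modal trees\<close>

primrec bag :: "'v mtree \<Rightarrow> 'v bag_tree" where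
  "bag (MTree \<Delta> \<Gamma>) = Node \<Delta> (mset (map (map_prod id bag) \<Gamma>))"

lemma mset_delete_at:
  assumes "valid_index i xs"
  shows "add_mset (elem_at xs i) (mset (delete_at xs i)) = mset xs"
proof -
  have "xs = take (i - 1) xs @ elem_at xs i # drop i xs"
    using assms id_take_nth_drop[of "i - 1" xs] by (auto simp: valid_index_def elem_at_def)
  from arg_cong[where f = mset, OF this] show ?thesis by (simp add: delete_at_def)
qed

lemma mset_replace_at:
  "valid_index i xs \<Longrightarrow> mset (replace_at xs i x) = add_mset x (mset (delete_at xs i))"
  by (cases i) (simp_all add: replace_at_def delete_at_def upd_conv_take_nth_drop valid_index_def)

lemma mset_swap_at: "valid_index i xs \<Longrightarrow> valid_index j xs \<Longrightarrow> mset (swap_at xs i j) = mset xs"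
  by (auto simp: swap_at_def elem_at_def valid_index_def intro!: mset_swap)

text \<open>Both sides of an equation between multisets lose their heads here, which requires the
  heads to differ. For \<open>J\<close> they do, since their labels satisfy \<alpha> > \<beta>. The
  detour through multisets avoids distinguishing i < j from j < i.\<close>

lemma mset_replace_delete_at:
  assumes "valid_index i xs" "valid_index j xs" "i \<noteq> j" "x \<noteq> elem_at xs j"
  obtains L where "mset (delete_at xs i) = add_mset (elem_at xs j) L"
    "mset (delete_at (replace_at xs i x) j) = add_mset x L"
proof -
  have "elem_at (replace_at xs i x) j = elem_at xs j" "valid_index j (replace_at xs i x)"
    using assms by (auto simp: elem_at_def replace_at_def valid_index_def)
  then have "add_mset (elem_at xs j) (mset (delete_at (replace_at xs i x) j)) =
      add_mset x (mset (delete_at xs i))"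
    using mset_delete_at mset_replace_at assms by metis
  with assms(4) that show thesis by (auto simp: add_eq_conv_ex)
qed

lemma rule_step_root: "root_step \<mu> T S \<Longrightarrow> rule_step \<mu> T S"
  using rule_step.intros[of "[]" T \<mu> S] by (cases T) simp

lemma rule_step_child:
  assumes "rule_step \<mu> X Y" "valid_index i \<Gamma>" "elem_at \<Gamma> i = (\<alpha>, X)"
  shows "rule_step \<mu> (MTree \<Delta> \<Gamma>) (MTree \<Delta> (replace_at \<Gamma> i (\<alpha>, Y)))"
  using assms(1)
proof cases
  case (1 k N)
  then show ?thesis
    using rule_step.intros[of "i # k" "MTree \<Delta> \<Gamma>" \<mu> N] assms(2,3) by (auto simp: valid_index_def)
qed

text \<open>Trades positions and grafting for closure under contexts, the form in which
  \<open>bstep\<close> is defined.\<close>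

lemma rule_step_induct [consumes 1, case_names root child]:
  assumes "rule_step \<mu> T S"
    and root: "\<And>T S. root_step \<mu> T S \<Longrightarrow> P T S"
    and child: "\<And>\<Delta> \<Gamma> i \<alpha> X Y. valid_index i \<Gamma> \<Longrightarrow> elem_at \<Gamma> i = (\<alpha>, X) \<Longrightarrow> P X Y \<Longrightarrow>
      P (MTree \<Delta> \<Gamma>) (MTree \<Delta> (replace_at \<Gamma> i (\<alpha>, Y)))"
  shows "P T S"
proof -
  have "k \<in> Pos T \<Longrightarrow> root_step \<mu> (subtree T k) N \<Longrightarrow> P T (graft T N k)" for k N
  proof (induction k arbitrary: T)
    case Nil
    then show ?case by (simp add: root)
  next
    case (Cons i k)
    obtain \<Delta> \<Gamma> where T: "T = MTree \<Delta> \<Gamma>" by (cases T)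
    obtain \<alpha> X where X: "elem_at \<Gamma> i = (\<alpha>, X)" by fastforce
    have "P X (graft X N k)"
      using Cons X T by (intro Cons.IH) auto
    then show ?case
      using child[of i \<Gamma> \<alpha> X] Cons.prems T X by (auto simp: valid_index_def)
  qed
  with assms(1) show ?thesis by (auto elim: rule_step.cases)
qed

lemma bstep_bag: "rule_step \<mu> T S \<Longrightarrow> \<mu> \<noteq> Sigma \<Longrightarrow> bstep \<mu> (bag T) (bag S)"
proof (induction rule: rule_step_induct)
  case (root T S)
  then show ?case
  proof (induction rule: root_step.induct)
    case (rho_plus i \<Delta> \<Gamma>)
    then show ?case by (simp add: bstep.rho_plus)
  next
    case (rho_minus i \<Delta> \<Gamma>)
    then show ?case by (simp add: bstep.rho_minus)
  next
    case (pi_plus i \<Gamma> \<Delta>)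
    then show ?case
      using mset_delete_at[OF pi_plus(1), symmetric] by (simp add: duplicate_at_def bstep.pi_plus)
  next
    case (pi_minus i \<Gamma> \<Delta>)
    then show ?case
      using mset_delete_at[OF pi_minus(1), symmetric] by (simp add: bstep.pi_minus)
  next
    case (four i \<Gamma> \<beta> \<Delta>' \<Gamma>' j S \<Delta>)
    then show ?case
      using mset_delete_at[OF four(1), symmetric] mset_delete_at[OF four(3), symmetric]
      by (simp add: mset_replace_at bstep.four)
  next
    case (lambda i \<Gamma> \<alpha> S \<beta> \<Delta>)
    then show ?case
      using mset_delete_at[OF lambda(1), symmetric] by (simp add: mset_replace_at bstep.lambda)
  next
    case (j i \<Gamma> j \<alpha> \<Delta>' \<Gamma>' \<beta> S \<Delta>)
    then obtain L where "mset (delete_at \<Gamma> i) = add_mset (\<beta>, S) L"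
      "mset (delete_at (replace_at \<Gamma> i (\<alpha>, MTree \<Delta>' (\<Gamma>' @ [(\<beta>, S)]))) j) =
        add_mset (\<alpha>, MTree \<Delta>' (\<Gamma>' @ [(\<beta>, S)])) L"
      using mset_replace_delete_at[of i \<Gamma> j "(\<alpha>, MTree \<Delta>' (\<Gamma>' @ [(\<beta>, S)]))"] by auto
    then show ?case
      using j mset_delete_at[OF j(1), symmetric] by (simp add: bstep.j)
  qed simp
next
  case (child \<Delta> \<Gamma> i \<alpha> X Y)
  then show ?case
    using mset_delete_at[OF child(1), symmetric] by (simp add: mset_replace_at bstep.child)
qed

lemma bag_sigma: "rule_step Sigma T S \<Longrightarrow> bag T = bag S"
proof (induction rule: rule_step_induct)
  case (root T S)
  then show ?case by cases (simp add: mset_swap_at)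
next
  case (child \<Delta> \<Gamma> i \<alpha> X Y)
  then show ?case
    using mset_delete_at[OF child(1), symmetric] by (simp add: mset_replace_at)
qed

lemma bag_eq_NodeE:
  assumes "Node \<Delta> G = bag T"
  obtains \<Gamma> where "T = MTree \<Delta> \<Gamma>" "image_mset (map_prod id bag) (mset \<Gamma>) = G"
  using assms by (cases T) auto

lemma image_mset_eq_add_msetE:
  assumes "image_mset (map_prod id bag) (mset \<Gamma>) = add_mset (\<alpha>, B) G"
  obtains i X where "valid_index i \<Gamma>" "elem_at \<Gamma> i = (\<alpha>, X)" "bag X = B"
    "image_mset (map_prod id bag) (mset (delete_at \<Gamma> i)) = G"
proof -
  have "(\<alpha>, B) \<in> map_prod id bag ` set \<Gamma>"
    using assms by (metis set_image_mset set_mset_mset union_single_eq_member)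
  then obtain X n where n: "bag X = B" "n < length \<Gamma>" "\<Gamma> ! n = (\<alpha>, X)"
    by (auto simp: in_set_conv_nth)
  then have i: "valid_index (Suc n) \<Gamma>" "elem_at \<Gamma> (Suc n) = (\<alpha>, X)"
    by (auto simp: valid_index_def elem_at_def)
  moreover have "image_mset (map_prod id bag) (mset (delete_at \<Gamma> (Suc n))) = G"
    using assms i n(1) mset_delete_at[OF i(1), symmetric] by simp
  ultimately show thesis using that n(1) by blast
qed

text \<open>Any occurrence of a matching child in the list will do, as the result is prescribed only
  up to the order of children.\<close>

lemma bstep_lift: "bstep \<mu> (bag T) B \<Longrightarrow> \<exists>S. rule_step \<mu> T S \<and> bag S = B"
proof (induction \<mu> "bag T" B arbitrary: T rule: bstep.induct)
  case (rho_plus i \<Delta> G)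
  then obtain \<Gamma> where "T = MTree \<Delta> \<Gamma>" "image_mset (map_prod id bag) (mset \<Gamma>) = G"
    by (elim bag_eq_NodeE)
  with rho_plus show ?case
    by (intro exI[of _ "MTree (duplicate_at \<Delta> i) \<Gamma>"]) (auto intro: rule_step_root root_step.intros)
next
  case (rho_minus i \<Delta> G)
  then obtain \<Gamma> where "T = MTree \<Delta> \<Gamma>" "image_mset (map_prod id bag) (mset \<Gamma>) = G"
    by (elim bag_eq_NodeE)
  with rho_minus show ?case
    by (intro exI[of _ "MTree (delete_at \<Delta> i) \<Gamma>"]) (auto intro: rule_step_root root_step.intros)
next
  case (pi_plus \<Delta> x G)
  obtain \<alpha> B where x: "x = (\<alpha>, B)" by fastforce
  obtain \<Gamma> where \<Gamma>: "T = MTree \<Delta> \<Gamma>" "image_mset (map_prod id bag) (mset \<Gamma>) = add_mset (\<alpha>, B) G"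
    using pi_plus x by (elim bag_eq_NodeE) simp
  from \<Gamma>(2) obtain i X where "valid_index i \<Gamma>" "elem_at \<Gamma> i = (\<alpha>, X)" "bag X = B"
    "image_mset (map_prod id bag) (mset (delete_at \<Gamma> i)) = G"
    by (rule image_mset_eq_add_msetE)
  moreover from this have "bag (MTree \<Delta> (duplicate_at \<Gamma> i)) = Node \<Delta> (add_mset x (add_mset x G))"
    using \<Gamma> x by (simp add: duplicate_at_def)
  ultimately show ?case
    unfolding \<Gamma> by (blast intro: rule_step_root root_step.pi_plus)
next
  case (pi_minus \<Delta> x G)
  obtain \<alpha> B where x: "x = (\<alpha>, B)" by fastforce
  obtain \<Gamma> where \<Gamma>: "T = MTree \<Delta> \<Gamma>" "image_mset (map_prod id bag) (mset \<Gamma>) = add_mset (\<alpha>, B) G"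
    using pi_minus x by (elim bag_eq_NodeE) simp
  from \<Gamma>(2) obtain i X where "valid_index i \<Gamma>" "elem_at \<Gamma> i = (\<alpha>, X)" "bag X = B"
    "image_mset (map_prod id bag) (mset (delete_at \<Gamma> i)) = G"
    by (rule image_mset_eq_add_msetE)
  with \<Gamma> x show ?case
    by (intro exI[of _ "MTree \<Delta> (delete_at \<Gamma> i)"]) (auto intro: rule_step_root root_step.intros)
next
  case (four \<Delta> \<beta> \<Delta>' B G' G)
  obtain \<Gamma> where \<Gamma>: "T = MTree \<Delta> \<Gamma>"
    "image_mset (map_prod id bag) (mset \<Gamma>) = add_mset (\<beta>, Node \<Delta>' (add_mset (\<beta>, B) G')) G"
    using four by (elim bag_eq_NodeE)
  from \<Gamma>(2) obtain i X where i: "valid_index i \<Gamma>" "elem_at \<Gamma> i = (\<beta>, X)"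
    "bag X = Node \<Delta>' (add_mset (\<beta>, B) G')"
    "image_mset (map_prod id bag) (mset (delete_at \<Gamma> i)) = G"
    by (rule image_mset_eq_add_msetE)
  from i(3)[symmetric] obtain \<Gamma>' where \<Gamma>': "X = MTree \<Delta>' \<Gamma>'"
    "image_mset (map_prod id bag) (mset \<Gamma>') = add_mset (\<beta>, B) G'"
    by (rule bag_eq_NodeE)
  from \<Gamma>'(2) obtain j S where "valid_index j \<Gamma>'" "elem_at \<Gamma>' j = (\<beta>, S)" "bag S = B"
    "image_mset (map_prod id bag) (mset (delete_at \<Gamma>' j)) = G'"
    by (rule image_mset_eq_add_msetE)
  with \<Gamma> \<Gamma>' i show ?case
    by (intro exI[of _ "MTree \<Delta> (replace_at \<Gamma> i (\<beta>, S))"])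
      (auto simp: mset_replace_at intro: rule_step_root root_step.intros)
next
  case (lambda \<alpha> \<beta> \<Delta> B G)
  obtain \<Gamma> where \<Gamma>: "T = MTree \<Delta> \<Gamma>" "image_mset (map_prod id bag) (mset \<Gamma>) = add_mset (\<alpha>, B) G"
    using lambda by (elim bag_eq_NodeE)
  from \<Gamma>(2) obtain i X where "valid_index i \<Gamma>" "elem_at \<Gamma> i = (\<alpha>, X)" "bag X = B"
    "image_mset (map_prod id bag) (mset (delete_at \<Gamma> i)) = G"
    by (rule image_mset_eq_add_msetE)
  with \<Gamma> lambda show ?case
    by (intro exI[of _ "MTree \<Delta> (replace_at \<Gamma> i (\<beta>, X))"])
      (auto simp: mset_replace_at intro: rule_step_root root_step.intros)
next
  case (j \<alpha> \<beta> \<Delta> \<Delta>' G' B G)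
  obtain \<Gamma> where \<Gamma>: "T = MTree \<Delta> \<Gamma>"
    "image_mset (map_prod id bag) (mset \<Gamma>) = add_mset (\<alpha>, Node \<Delta>' G') (add_mset (\<beta>, B) G)"
    using j by (elim bag_eq_NodeE)
  from \<Gamma>(2) obtain i X where i: "valid_index i \<Gamma>" "elem_at \<Gamma> i = (\<alpha>, X)" "bag X = Node \<Delta>' G'"
    "image_mset (map_prod id bag) (mset (delete_at \<Gamma> i)) = add_mset (\<beta>, B) G"
    by (rule image_mset_eq_add_msetE)
  from i(3)[symmetric] obtain \<Gamma>' where \<Gamma>': "X = MTree \<Delta>' \<Gamma>'"
    "image_mset (map_prod id bag) (mset \<Gamma>') = G'"
    by (rule bag_eq_NodeE)
  \<comment> \<open>The second child is looked up in the full list, because both indices of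
    \<open>J\<close> refer to \<Gamma>. It cannot coincide with the first, the labels being
    different.\<close>
  from \<Gamma>(2)[unfolded add_mset_commute[of "(\<alpha>, Node \<Delta>' G')"]] obtain k S
    where k: "valid_index k \<Gamma>" "elem_at \<Gamma> k = (\<beta>, S)" "bag S = B"
    by (rule image_mset_eq_add_msetE)
  let ?x = "(\<alpha>, MTree \<Delta>' (\<Gamma>' @ [(\<beta>, S)]))"
  have "i \<noteq> k" "?x \<noteq> elem_at \<Gamma> k" using i k j by auto
  with i k obtain L where "mset (delete_at \<Gamma> i) = add_mset (\<beta>, S) L"
    "mset (delete_at (replace_at \<Gamma> i ?x) k) = add_mset ?x L"
    by (metis mset_replace_delete_at)
  with i k \<Gamma>' have "bag (MTree \<Delta> (delete_at (replace_at \<Gamma> i ?x) k)) =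
    Node \<Delta> (add_mset (\<alpha>, Node \<Delta>' (add_mset (\<beta>, B) G')) G)" by simp
  moreover have "rule_step J T (MTree \<Delta> (delete_at (replace_at \<Gamma> i ?x) k))"
    unfolding \<Gamma> using i k j \<Gamma>' \<open>i \<noteq> k\<close> by (auto intro: rule_step_root root_step.intros)
  ultimately show ?case by blast
next
  case (child \<mu> A B \<Delta> \<alpha> G)
  obtain \<Gamma> where \<Gamma>: "T = MTree \<Delta> \<Gamma>" "image_mset (map_prod id bag) (mset \<Gamma>) = add_mset (\<alpha>, A) G"
    using child by (elim bag_eq_NodeE)
  from \<Gamma>(2) obtain i X where i: "valid_index i \<Gamma>" "elem_at \<Gamma> i = (\<alpha>, X)" "bag X = A"
    "image_mset (map_prod id bag) (mset (delete_at \<Gamma> i)) = G"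
    by (rule image_mset_eq_add_msetE)
  from child i obtain Y where "rule_step \<mu> X Y" "bag Y = B" by blast
  with \<Gamma> i show ?case
    by (intro exI[of _ "MTree \<Delta> (replace_at \<Gamma> i (\<alpha>, Y))"])
      (auto simp: mset_replace_at intro: rule_step_child)
qed

section \<open>Sorting children by \<open>Sigma\<close> steps\<close>

lemma sigma_steps_permute:
  "mset \<Gamma> = mset \<Gamma>' \<Longrightarrow> (rule_step Sigma)\<^sup>*\<^sup>* (MTree \<Delta> (ps @ \<Gamma>)) (MTree \<Delta> (ps @ \<Gamma>'))"
proof (induction \<Gamma>' arbitrary: ps \<Gamma>)
  case (Cons x xs)
  then obtain y \<Gamma>1 where \<Gamma>: "\<Gamma> = y # \<Gamma>1" by (cases \<Gamma>) auto
  show ?case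
  proof (cases "x = y")
    case True
    then show ?thesis using Cons.IH[of \<Gamma>1 "ps @ [x]"] Cons.prems \<Gamma> by simp
  next
    case False
    then have "x \<in> set \<Gamma>1"
      using Cons.prems \<Gamma> by (metis list.set_intros(1) mset_eq_setD set_ConsD)
    then obtain us vs where \<Gamma>1: "\<Gamma>1 = us @ x # vs" by (meson split_list)
    \<comment> \<open>Indices start at 1: \<open>?i\<close> is the place of \<open>y\<close>, right
      behind the sorted prefix \<open>ps\<close>, and \<open>?j\<close> is that of \<open>x\<close>,
      behind \<open>y\<close> and \<open>us\<close>.\<close>
    let ?i = "Suc (length ps)" and ?j = "Suc (Suc (length ps + length us))"
    have "swap_at (ps @ \<Gamma>) ?i ?j = (ps @ [x]) @ us @ y # vs"
      unfolding \<Gamma> \<Gamma>1 by (simp add: swap_at_def elem_at_def nth_append list_update_append)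
    then have "rule_step Sigma (MTree \<Delta> (ps @ \<Gamma>)) (MTree \<Delta> ((ps @ [x]) @ us @ y # vs))"
      using root_step.sigma[of ?i "ps @ \<Gamma>" ?j \<Delta>]
      by (auto simp: \<Gamma> \<Gamma>1 valid_index_def intro: rule_step_root)
    also have "(rule_step Sigma)\<^sup>*\<^sup>* \<dots> (MTree \<Delta> ((ps @ [x]) @ xs))"
      using Cons.prems unfolding \<Gamma> \<Gamma>1 by (intro Cons.IH) simp
    finally show ?thesis by simp
  qed
qed simp

lemma rule_steps_child:
  "(rule_step \<mu>)\<^sup>*\<^sup>* X Y \<Longrightarrow>
   (rule_step \<mu>)\<^sup>*\<^sup>* (MTree \<Delta> (ps @ (\<alpha>, X) # qs)) (MTree \<Delta> (ps @ (\<alpha>, Y) # qs))"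
proof (induction rule: rtranclp_induct)
  case (step Y Z)
  then have "rule_step \<mu> (MTree \<Delta> (ps @ (\<alpha>, Y) # qs)) (MTree \<Delta> (ps @ (\<alpha>, Z) # qs))"
    using rule_step_child[of \<mu> Y Z "Suc (length ps)" "ps @ (\<alpha>, Y) # qs" \<alpha>]
    by (simp add: valid_index_def elem_at_def replace_at_def)
  with step show ?case by simp
qed simp

lemma rule_steps_children:
  "list_all2 (\<lambda>(\<alpha>, X) (\<beta>, Y). \<alpha> = \<beta> \<and> (rule_step \<mu>)\<^sup>*\<^sup>* X Y) \<Gamma> \<Gamma>' \<Longrightarrow>
   (rule_step \<mu>)\<^sup>*\<^sup>* (MTree \<Delta> (ps @ \<Gamma>)) (MTree \<Delta> (ps @ \<Gamma>'))"
proof (induction arbitrary: ps rule: list_all2_induct)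
  case (Cons x xs y ys)
  then obtain \<alpha> X Y where "x = (\<alpha>, X)" "y = (\<alpha>, Y)" "(rule_step \<mu>)\<^sup>*\<^sup>* X Y" by auto
  then show ?case
    using rule_steps_child[of \<mu> X Y \<Delta> ps \<alpha> xs] Cons.IH[of "ps @ [y]"] by simp
qed simp

text \<open>Sorting is done from the root downwards: once the children are aligned so that
  corresponding ones have equal bags, the induction hypothesis treats each pair separately.\<close>

lemma bag_eq_imp_sigma_steps: "bag T = bag S \<Longrightarrow> (rule_step Sigma)\<^sup>*\<^sup>* T S"
proof (induction T arbitrary: S)
  case (MTree \<Delta> \<Gamma>)
  then obtain \<Gamma>' where S: "S = MTree \<Delta> \<Gamma>'"
    and eq: "mset (map (map_prod id bag) \<Gamma>) = mset (map (map_prod id bag) \<Gamma>')"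
    by (cases S) auto
  \<comment> \<open>The images under \<open>bag\<close> agree as multisets, but actual children have
    to be permuted. Viewing the map as a relation lets a reordering of the images induce a
    reordering of \<Gamma>.\<close>
  have "list_all2 (\<lambda>y x. y = map_prod id bag x) (map (map_prod id bag) \<Gamma>) \<Gamma>"
    by (simp add: list_all2_conv_all_nth)
  from list_all2_reorder_left_invariance[OF this eq[symmetric]]
  obtain \<Gamma>'' where "list_all2 (\<lambda>y x. y = map_prod id bag x) (map (map_prod id bag) \<Gamma>') \<Gamma>''"
    and mset: "mset \<Gamma>'' = mset \<Gamma>" by blast
  then have "list_all2 (\<lambda>x y. map_prod id bag x = map_prod id bag y) \<Gamma>' \<Gamma>''"
    by (simp only: list_all2_map1 eq_commute)
  then have all: "list_all2 (\<lambda>x y. map_prod id bag x = map_prod id bag y) \<Gamma>'' \<Gamma>'"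
    by (metis (mono_tags, lifting) list_all2_lengthD list_all2_nthD list_all2_all_nthI)
  have IH: "(rule_step Sigma)\<^sup>*\<^sup>* X Y" if "(\<alpha>, X) \<in> set \<Gamma>''" "bag X = bag Y" for \<alpha> X Y
    using that(2) by (rule MTree.IH[rotated 2]) (use that(1) mset_eq_setD[OF mset] in auto)
  have "list_all2 (\<lambda>(\<alpha>, X) (\<beta>, Y). \<alpha> = \<beta> \<and> (rule_step Sigma)\<^sup>*\<^sup>* X Y) \<Gamma>'' \<Gamma>'"
    by (rule list.rel_mono_strong[OF all]) (auto intro: IH)
  from rule_steps_children[OF this, of \<Delta> "[]"]
  have "(rule_step Sigma)\<^sup>*\<^sup>* (MTree \<Delta> \<Gamma>'') (MTree \<Delta> \<Gamma>')" by simp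
  moreover have "(rule_step Sigma)\<^sup>*\<^sup>* (MTree \<Delta> \<Gamma>) (MTree \<Delta> \<Gamma>'')"
    using sigma_steps_permute[OF mset[symmetric], of \<Delta> "[]"] by simp
  ultimately show ?case unfolding S by simp
qed

section \<open>Assembling the normal sequence of rules\<close>

lemma rule_seq_append: "rule_seq (\<Omega> @ \<Omega>') T S \<longleftrightarrow> (\<exists>U. rule_seq \<Omega> T U \<and> rule_seq \<Omega>' U S)"
  by (induction \<Omega> arbitrary: T) auto

lemma bsteps_lift:
  "(bstep_in K)\<^sup>*\<^sup>* (bag T) B \<Longrightarrow> \<exists>\<Omega>\<in>lists K. \<exists>S. rule_seq \<Omega> T S \<and> bag S = B"
proof (induction "bag T" arbitrary: T rule: converse_rtranclp_induct)
  case base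
  moreover have "rule_seq [] T T" by simp
  ultimately show ?case by blast
next
  case (step A)
  then obtain \<kappa> where \<kappa>: "\<kappa> \<in> K" "bstep \<kappa> (bag T) A" by (auto simp: bstep_in_def)
  then obtain U where U: "rule_step \<kappa> T U" "A = bag U" using bstep_lift by blast
  with step obtain \<Omega> S where "\<Omega> \<in> lists K" "rule_seq \<Omega> U S" "bag S = B" by blast
  with \<kappa> U have "\<kappa> # \<Omega> \<in> lists K" "rule_seq (\<kappa> # \<Omega>) T S" by auto
  with \<open>bag S = B\<close> show ?case by blast
qed

lemma sigma_steps_imp_rule_seq:
  "(rule_step Sigma)\<^sup>*\<^sup>* T S \<Longrightarrow> \<exists>\<Omega>\<in>lists structural_rules. rule_seq \<Omega> T S"
proof (induction rule: converse_rtranclp_induct)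
  case base
  have "rule_seq [] S S" by simp
  then show ?case by blast
next
  case (step T U)
  then obtain \<Omega> where "\<Omega> \<in> lists structural_rules" "rule_seq \<Omega> U S" by blast
  with step have "Sigma # \<Omega> \<in> lists structural_rules" "rule_seq (Sigma # \<Omega>) T S"
    by (auto simp: structural_rules_def)
  then show ?case by blast
qed

lemma trc_steps_bag: "T \<hookrightarrow>\<^sup>* S \<Longrightarrow> (bstep_in (- structural_rules))\<^sup>*\<^sup>* (bag T) (bag S)"
proof (induction rule: rtranclp_induct)
  case (step U S)
  then obtain \<mu> where \<mu>: "rule_step \<mu> U S" by (auto simp: trc_step_def)
  show ?case
  proof (cases "\<mu> = Sigma")
    case True
    with \<mu> step show ?thesis using bag_sigma by metis
  next
    case False
    with \<mu> have "bstep_in (- structural_rules) (bag U) (bag S)"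
      using bstep_bag by (auto simp: bstep_in_def structural_rules_def)
    with step show ?thesis by simp
  qed
qed simp

theorem mainTheorem3:
  fixes T S :: "'v mtree"
  assumes "T \<hookrightarrow>\<^sup>* S"
  shows "\<exists>\<Omega>. normal_seq \<Omega> \<and> rule_seq \<Omega> T S"
proof -
  obtain A1 A2 A3 where A: "(bstep_in replicative_rules)\<^sup>*\<^sup>* (bag T) A1"
    "(bstep_in modal_rules)\<^sup>*\<^sup>* A1 A2" "(bstep_in decreasing_rules)\<^sup>*\<^sup>* A2 A3"
    "(bstep_in atomic_rules)\<^sup>*\<^sup>* A3 (bag S)"
    using bsteps_normal_form[OF trc_steps_bag[OF assms]] by blast
  obtain \<Omega>1 T1 where 1: "\<Omega>1 \<in> lists replicative_rules" "rule_seq \<Omega>1 T T1" "bag T1 = A1"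
    using bsteps_lift[OF A(1)] by blast
  obtain \<Omega>2 T2 where 2: "\<Omega>2 \<in> lists modal_rules" "rule_seq \<Omega>2 T1 T2" "bag T2 = A2"
    using bsteps_lift A(2) 1(3) by blast
  obtain \<Omega>3 T3 where 3: "\<Omega>3 \<in> lists decreasing_rules" "rule_seq \<Omega>3 T2 T3" "bag T3 = A3"
    using bsteps_lift A(3) 2(3) by blast
  obtain \<Omega>4 T4 where 4: "\<Omega>4 \<in> lists atomic_rules" "rule_seq \<Omega>4 T3 T4" "bag T4 = bag S"
    using bsteps_lift A(4) 3(3) by blast
  obtain \<Omega>5 where 5: "\<Omega>5 \<in> lists structural_rules" "rule_seq \<Omega>5 T4 S"
    using sigma_steps_imp_rule_seq bag_eq_imp_sigma_steps 4(3) by blast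
  have "normal_seq (\<Omega>1 @ \<Omega>2 @ \<Omega>3 @ \<Omega>4 @ \<Omega>5)"
    unfolding normal_seq_def using 1(1) 2(1) 3(1) 4(1) 5(1) by blast
  moreover have "rule_seq (\<Omega>1 @ \<Omega>2 @ \<Omega>3 @ \<Omega>4 @ \<Omega>5) T S"
    unfolding rule_seq_append using 1(2) 2(2) 3(2) 4(2) 5(2) by blast
  ultimately show ?thesis by blast
qed

end
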